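(* Let $F\dashv U$, $F\colon\mathcal A\to\mathcal B$, be an adjunction with unit $\eta$ and counit $\epsilon$, let $C\colon\mathcal A\to\mathcal A$ be an endofunctor, and let $S,V\colon\mathcal B\to\mathcal B$ be two lifts of $C$ through the adjunction, with natural isomorphisms $\Omega\colon CU\to US$ and $\Phi\colon CU\to UV$. Let $\Gamma^{S,V}$ be the Galois map of $(S,V)$. Then: (1) The inverse of $\Gamma^{S,V}$ is $\Gamma^{V,S}$. (2) $\Gamma^{S,V}$ maps a morphism $f\colon FX\to SY$ to the composite $$FX\xrightarrow{F\eta_X}FUFX\xrightarrow{FUf}FUSY\xrightarrow{F(\Phi_Y\circ\Omega_Y^{-1})}FUVY\xrightarrow{\epsilon_{VY}}VY.$$ (3) Let $T=FU$ and let $\chi^S\colon TS\to ST$ and $\chi^V\colon TV\to VT$ be the lax morphisms determined by the two lifts. Then $\Gamma^{S,V}(\chi^S)=\chi^V$ up to the identification $TS\cong TV$ given by $F(\Phi\circ\Omega^{-1})$; that is, for every object $Y$ of $\mathcal B$, applying $\Gamma^{S,V}$ to $\chi^S_Y\colon F(USY)\to S(TY)$ gives $$\Gamma^{S,V}(\chi^S_Y)=\chi^V_Y\circ F(\Phi_Y\circ\Omega_Y^{-1}).$$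
   Context: A lift of $C\colon\mathcal A\to\mathcal A$ through the adjunction $F\dashv U$ is an endofunctor $S\colon\mathcal B\to\mathcal B$ together with a natural isomorphism $\Omega\colon CU\to US$. The Galois map of the pair $(S,V)$ is the natural isomorphism $\Gamma^{S,V}\colon\mathcal B(F-,S-)\to\mathcal B(F-,V-)$ of functors $\mathcal A^{\mathrm{op}}\times\mathcal B\to\mathsf{Set}$ given in components by $$\mathcal B(FX,SY)\cong\mathcal A(X,USY)\to\mathcal A(X,UVY)\cong\mathcal B(FX,VY),$$ where the outer bijections are those of the adjunction and the middle map is postcomposition with $\Phi_Y\circ\Omega_Y^{-1}$. ($\Gamma^{V,S}$ is defined in the same way with $(S,\Omega)$ and $(V,\Phi)$ interchanged.) The lax morphism determined by $(S,\Omega)$ is $\chi^S:=\Lambda U\circ F\Omega^{-1}\colon TS=FUS\to SFU=ST$, where $\Lambda\colon FC\to SF$ corresponds under the adjunction to $\Omega F\circ C\eta\colon C\to USF$. $\chi^V$ is defined in the same way from $(V,\Phi)$. *)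

theory Defs
  imports "HOL-Library.FuncSet"
begin

section \<open>Categories, functors, natural transformations\<close>

text \<open>Every arrow carries its domain and codomain, so hom-sets are disjoint. \<open>Comp\<close> is a total
  function whose value is only meaningful on composable pairs.\<close>

record ('o, 'm) cat =
  Obj :: "'o set"
  Arr :: "'m set"
  Dom :: "'m \<Rightarrow> 'o"
  Cod :: "'m \<Rightarrow> 'o"
  Ide :: "'o \<Rightarrow> 'm"
  Comp :: "'m \<Rightarrow> 'm \<Rightarrow> 'm"  (infixr "\<cdot>\<index>" 70)

definition Hom :: "('o, 'm) cat \<Rightarrow> 'o \<Rightarrow> 'o \<Rightarrow> 'm set" where
  "Hom C X Y = {f \<in> Arr C. Dom C f = X \<and> Cod C f = Y}"

locale category =
  fixes C :: "('o, 'm) cat" (structure)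
  assumes dom_obj: "f \<in> Arr C \<Longrightarrow> Dom C f \<in> Obj C"
    and cod_obj: "f \<in> Arr C \<Longrightarrow> Cod C f \<in> Obj C"
    and ide_hom: "X \<in> Obj C \<Longrightarrow> Ide C X \<in> Hom C X X"
    and comp_hom: "f \<in> Hom C X Y \<Longrightarrow> g \<in> Hom C Y Z \<Longrightarrow> g \<cdot> f \<in> Hom C X Z"
    and ide_left: "f \<in> Hom C X Y \<Longrightarrow> Ide C Y \<cdot> f = f"
    and ide_right: "f \<in> Hom C X Y \<Longrightarrow> f \<cdot> Ide C X = f"
    and comp_assoc: "f \<in> Hom C W X \<Longrightarrow> g \<in> Hom C X Y \<Longrightarrow> h \<in> Hom C Y Z \<Longrightarrow>
          (h \<cdot> g) \<cdot> f = h \<cdot> (g \<cdot> f)"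

definition inverse_arrows :: "('o, 'm) cat \<Rightarrow> 'm \<Rightarrow> 'm \<Rightarrow> bool" where
  "inverse_arrows C f g \<longleftrightarrow> f \<in> Arr C \<and> g \<in> Hom C (Cod C f) (Dom C f) \<and>
     g \<cdot>\<^bsub>C\<^esub> f = Ide C (Dom C f) \<and> f \<cdot>\<^bsub>C\<^esub> g = Ide C (Cod C f)"

definition iso_arrow :: "('o, 'm) cat \<Rightarrow> 'm \<Rightarrow> bool" where
  "iso_arrow C f \<longleftrightarrow> (\<exists>g. inverse_arrows C f g)"

definition inv_arrow :: "('o, 'm) cat \<Rightarrow> 'm \<Rightarrow> 'm" where
  "inv_arrow C f = (THE g. inverse_arrows C f g)"

record ('oa, 'ma, 'ob, 'mb) ftr =
  OMap :: "'oa \<Rightarrow> 'ob"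
  AMap :: "'ma \<Rightarrow> 'mb"

locale is_functor = A: category A + B: category B
  for A :: "('oa, 'ma) cat" and B :: "('ob, 'mb) cat" +
  fixes F :: "('oa, 'ma, 'ob, 'mb) ftr"
  assumes omap_obj: "X \<in> Obj A \<Longrightarrow> OMap F X \<in> Obj B"
    and amap_hom: "f \<in> Hom A X Y \<Longrightarrow> AMap F f \<in> Hom B (OMap F X) (OMap F Y)"
    and amap_ide: "X \<in> Obj A \<Longrightarrow> AMap F (Ide A X) = Ide B (OMap F X)"
    and amap_comp: "f \<in> Hom A X Y \<Longrightarrow> g \<in> Hom A Y Z \<Longrightarrow>
          AMap F (g \<cdot>\<^bsub>A\<^esub> f) = AMap F g \<cdot>\<^bsub>B\<^esub> AMap F f"

definition comp_functor ::
    "('ob, 'mb, 'oc, 'mc) ftr \<Rightarrow> ('oa, 'ma, 'ob, 'mb) ftr \<Rightarrow> ('oa, 'ma, 'oc, 'mc) ftr"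
    (infixr "\<odot>" 75) where
  "G \<odot> F = \<lparr>OMap = \<lambda>X. OMap G (OMap F X), AMap = \<lambda>f. AMap G (AMap F f)\<rparr>"

text \<open>A transformation is its family of components; only the components at objects of the
  source category matter.\<close>

locale nat_trans = F: is_functor A B F + G: is_functor A B G
  for A :: "('oa, 'ma) cat" and B :: "('ob, 'mb) cat"
    and F G :: "('oa, 'ma, 'ob, 'mb) ftr" +
  fixes \<alpha> :: "'oa \<Rightarrow> 'mb"
  assumes component_hom: "X \<in> Obj A \<Longrightarrow> \<alpha> X \<in> Hom B (OMap F X) (OMap G X)"
    and naturality: "f \<in> Hom A X Y \<Longrightarrow> AMap G f \<cdot>\<^bsub>B\<^esub> \<alpha> X = \<alpha> Y \<cdot>\<^bsub>B\<^esub> AMap F f"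

locale nat_iso = nat_trans +
  assumes component_iso: "X \<in> Obj A \<Longrightarrow> iso_arrow B (\<alpha> X)"

definition inverse_nat_trans ::
    "('oa, 'ma) cat \<Rightarrow> ('ob, 'mb) cat \<Rightarrow> ('oa, 'ma, 'ob, 'mb) ftr \<Rightarrow> ('oa, 'ma, 'ob, 'mb) ftr \<Rightarrow>
     ('oa \<Rightarrow> 'mb) \<Rightarrow> ('oa \<Rightarrow> 'mb) \<Rightarrow> bool" where
  "inverse_nat_trans A B F G \<alpha> \<beta> \<longleftrightarrow>
     nat_trans A B F G \<alpha> \<and> nat_trans A B G F \<beta> \<and>
     (\<forall>X \<in> Obj A. inverse_arrows B (\<alpha> X) (\<beta> X))"

definition vcomp :: "('ob, 'mb) cat \<Rightarrow> ('oa \<Rightarrow> 'mb) \<Rightarrow> ('oa \<Rightarrow> 'mb) \<Rightarrow> 'oa \<Rightarrow> 'mb" where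
  "vcomp B \<beta> \<alpha> = (\<lambda>X. \<beta> X \<cdot>\<^bsub>B\<^esub> \<alpha> X)"

definition inv_trans :: "('ob, 'mb) cat \<Rightarrow> ('oa \<Rightarrow> 'mb) \<Rightarrow> 'oa \<Rightarrow> 'mb" where
  "inv_trans B \<alpha> = (\<lambda>X. inv_arrow B (\<alpha> X))"

text \<open>\<open>whisker_left G \<alpha>\<close> is \<open>G\<alpha>\<close> and \<open>whisker_right \<alpha> F\<close> is \<open>\<alpha>F\<close>.\<close>

definition whisker_left ::
    "('ob, 'mb, 'oc, 'mc) ftr \<Rightarrow> ('oa \<Rightarrow> 'mb) \<Rightarrow> 'oa \<Rightarrow> 'mc" where
  "whisker_left G \<alpha> = (\<lambda>X. AMap G (\<alpha> X))"

definition whisker_right ::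
    "('ob \<Rightarrow> 'mc) \<Rightarrow> ('oa, 'ma, 'ob, 'mb) ftr \<Rightarrow> 'oa \<Rightarrow> 'mc" where
  "whisker_right \<alpha> F = (\<lambda>X. \<alpha> (OMap F X))"


section \<open>The functors \<open>\<B>(F-,S-) : \<A>\<^sup>o\<^sup>p \<times> \<B> \<rightarrow> Set\<close>\<close>

definition op_cat :: "('o, 'm) cat \<Rightarrow> ('o, 'm) cat" where
  "op_cat C = \<lparr>Obj = Obj C, Arr = Arr C, Dom = Cod C, Cod = Dom C, Ide = Ide C,
     Comp = \<lambda>g f. f \<cdot>\<^bsub>C\<^esub> g\<rparr>"

definition prod_cat ::
    "('oa, 'ma) cat \<Rightarrow> ('ob, 'mb) cat \<Rightarrow> ('oa \<times> 'ob, 'ma \<times> 'mb) cat" where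
  "prod_cat A B = \<lparr>Obj = Obj A \<times> Obj B, Arr = Arr A \<times> Arr B,
     Dom = map_prod (Dom A) (Dom B), Cod = map_prod (Cod A) (Cod B),
     Ide = map_prod (Ide A) (Ide B),
     Comp = \<lambda>(g, g') (f, f'). (g \<cdot>\<^bsub>A\<^esub> f, g' \<cdot>\<^bsub>B\<^esub> f')\<rparr>"

text \<open>The category of all sets of elements of type \<open>'a\<close>. An arrow is a triple of domain, function
  and codomain, the function being \<^const>\<open>undefined\<close> off the domain so that equality of arrows
  is equality of maps.\<close>

type_synonym 'a set_arr = "'a set \<times> ('a \<Rightarrow> 'a) \<times> 'a set"

definition set_map :: "'a set_arr \<Rightarrow> 'a \<Rightarrow> 'a" where
  "set_map t = fst (snd t)"

definition set_cat :: "('a set, 'a set_arr) cat" where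
  "set_cat = \<lparr>Obj = UNIV, Arr = {(P, h, Q). h \<in> P \<rightarrow>\<^sub>E Q},
     Dom = (\<lambda>(P, h, Q). P), Cod = (\<lambda>(P, h, Q). Q),
     Ide = (\<lambda>P. (P, restrict (\<lambda>x. x) P, P)),
     Comp = (\<lambda>(Q', k, R) (P, h, Q). (P, compose P k h, R))\<rparr>"

definition hom_functor :: "('o, 'm) cat \<Rightarrow> ('o \<times> 'o, 'm \<times> 'm, 'm set, 'm set_arr) ftr" where
  "hom_functor B = \<lparr>OMap = \<lambda>(X, Y). Hom B X Y,
     AMap = \<lambda>(f, g). (Hom B (Cod B f) (Dom B g),
                      restrict (\<lambda>h. g \<cdot>\<^bsub>B\<^esub> (h \<cdot>\<^bsub>B\<^esub> f)) (Hom B (Cod B f) (Dom B g)),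
                      Hom B (Dom B f) (Cod B g))\<rparr>"

definition prod_functor ::
    "('oa, 'ma, 'oc, 'mc) ftr \<Rightarrow> ('ob, 'mb, 'od, 'md) ftr \<Rightarrow>
     ('oa \<times> 'ob, 'ma \<times> 'mb, 'oc \<times> 'od, 'mc \<times> 'md) ftr" where
  "prod_functor F G = \<lparr>OMap = map_prod (OMap F) (OMap G), AMap = map_prod (AMap F) (AMap G)\<rparr>"

text \<open>The opposite functor of \<open>F\<close> has the same underlying maps as \<open>F\<close>, so \<open>F\<close> itself serves as
  the first factor here.\<close>

definition hom_FS ::
    "('ob, 'mb) cat \<Rightarrow> ('oa, 'ma, 'ob, 'mb) ftr \<Rightarrow> ('ob, 'mb, 'ob, 'mb) ftr \<Rightarrow>
     ('oa \<times> 'ob, 'ma \<times> 'mb, 'mb set, 'mb set_arr) ftr" where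
  "hom_FS B F S = hom_functor B \<odot> prod_functor F S"


section \<open>Adjunctions\<close>

text \<open>An adjunction \<open>F \<stileturn> U\<close> is a family of bijections \<open>\<phi> X Y : \<B>(FX,Y) \<rightarrow> \<A>(X,UY)\<close>, natural
  in \<open>X\<close> and \<open>Y\<close>.\<close>

locale adjunction = F: is_functor A B F + U: is_functor B A U
  for A :: "('oa, 'ma) cat" and B :: "('ob, 'mb) cat"
    and F :: "('oa, 'ma, 'ob, 'mb) ftr" and U :: "('ob, 'mb, 'oa, 'ma) ftr" +
  fixes \<phi> :: "'oa \<Rightarrow> 'ob \<Rightarrow> 'mb \<Rightarrow> 'ma"
  assumes \<phi>_bij: "X \<in> Obj A \<Longrightarrow> Y \<in> Obj B \<Longrightarrow>
          bij_betw (\<phi> X Y) (Hom B (OMap F X) Y) (Hom A X (OMap U Y))"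
    and \<phi>_natural: "f \<in> Hom A X' X \<Longrightarrow> h \<in> Hom B (OMap F X) Y \<Longrightarrow> g \<in> Hom B Y Y' \<Longrightarrow>
          \<phi> X' Y' (g \<cdot>\<^bsub>B\<^esub> (h \<cdot>\<^bsub>B\<^esub> AMap F f)) = AMap U g \<cdot>\<^bsub>A\<^esub> (\<phi> X Y h \<cdot>\<^bsub>A\<^esub> f)"

definition adj_inv ::
    "('ob, 'mb) cat \<Rightarrow> ('oa, 'ma, 'ob, 'mb) ftr \<Rightarrow> ('oa \<Rightarrow> 'ob \<Rightarrow> 'mb \<Rightarrow> 'ma) \<Rightarrow>
     'oa \<Rightarrow> 'ob \<Rightarrow> 'ma \<Rightarrow> 'mb" where
  "adj_inv B F \<phi> X Y = inv_into (Hom B (OMap F X) Y) (\<phi> X Y)"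

definition adj_unit ::
    "('ob, 'mb) cat \<Rightarrow> ('oa, 'ma, 'ob, 'mb) ftr \<Rightarrow> ('oa \<Rightarrow> 'ob \<Rightarrow> 'mb \<Rightarrow> 'ma) \<Rightarrow> 'oa \<Rightarrow> 'ma" where
  "adj_unit B F \<phi> X = \<phi> X (OMap F X) (Ide B (OMap F X))"

definition adj_counit ::
    "('oa, 'ma) cat \<Rightarrow> ('ob, 'mb) cat \<Rightarrow> ('oa, 'ma, 'ob, 'mb) ftr \<Rightarrow> ('ob, 'mb, 'oa, 'ma) ftr \<Rightarrow>
     ('oa \<Rightarrow> 'ob \<Rightarrow> 'mb \<Rightarrow> 'ma) \<Rightarrow> 'ob \<Rightarrow> 'mb" where
  "adj_counit A B F U \<phi> Y = adj_inv B F \<phi> (OMap U Y) Y (Ide A (OMap U Y))"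


section \<open>Lifts, Galois maps and lax morphisms\<close>

definition is_lift ::
    "('oa, 'ma) cat \<Rightarrow> ('ob, 'mb) cat \<Rightarrow> ('ob, 'mb, 'oa, 'ma) ftr \<Rightarrow> ('oa, 'ma, 'oa, 'ma) ftr \<Rightarrow>
     ('ob, 'mb, 'ob, 'mb) ftr \<Rightarrow> ('ob \<Rightarrow> 'ma) \<Rightarrow> bool" where
  "is_lift A B U C S \<Omega> \<longleftrightarrow> is_functor B B S \<and> nat_iso B A (C \<odot> U) (U \<odot> S) \<Omega>"

text \<open>\<open>lift_compare A \<Omega> \<Phi>\<close> is \<open>\<Phi> \<circ> \<Omega>\<inverse> : US \<rightarrow> UV\<close>.\<close>

definition lift_compare :: "('oa, 'ma) cat \<Rightarrow> ('ob \<Rightarrow> 'ma) \<Rightarrow> ('ob \<Rightarrow> 'ma) \<Rightarrow> 'ob \<Rightarrow> 'ma" where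
  "lift_compare A \<Omega> \<Phi> = vcomp A \<Phi> (inv_trans A \<Omega>)"

definition galois_map ::
    "('oa, 'ma) cat \<Rightarrow> ('ob, 'mb) cat \<Rightarrow> ('oa, 'ma, 'ob, 'mb) ftr \<Rightarrow>
     ('oa \<Rightarrow> 'ob \<Rightarrow> 'mb \<Rightarrow> 'ma) \<Rightarrow>
     ('ob, 'mb, 'ob, 'mb) ftr \<Rightarrow> ('ob \<Rightarrow> 'ma) \<Rightarrow> ('ob, 'mb, 'ob, 'mb) ftr \<Rightarrow> ('ob \<Rightarrow> 'ma) \<Rightarrow>
     'oa \<times> 'ob \<Rightarrow> 'mb set_arr" where
  "galois_map A B F \<phi> S \<Omega> V \<Phi> = (\<lambda>(X, Y).
     (Hom B (OMap F X) (OMap S Y),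
      restrict (\<lambda>f. adj_inv B F \<phi> X (OMap V Y)
                      (lift_compare A \<Omega> \<Phi> Y \<cdot>\<^bsub>A\<^esub> \<phi> X (OMap S Y) f))
        (Hom B (OMap F X) (OMap S Y)),
      Hom B (OMap F X) (OMap V Y)))"

text \<open>\<open>lift_mate\<close> is \<open>\<Lambda> : FC \<rightarrow> SF\<close>, the transpose of \<open>\<Omega>F \<circ> C\<eta> : C \<rightarrow> USF\<close>; \<open>lax_morphism\<close> is
  \<open>\<chi> = \<Lambda>U \<circ> F\<Omega>\<inverse> : FUS \<rightarrow> SFU\<close>.\<close>

definition lift_mate ::
    "('oa, 'ma) cat \<Rightarrow> ('ob, 'mb) cat \<Rightarrow> ('oa, 'ma, 'ob, 'mb) ftr \<Rightarrow>
     ('oa \<Rightarrow> 'ob \<Rightarrow> 'mb \<Rightarrow> 'ma) \<Rightarrow> ('oa, 'ma, 'oa, 'ma) ftr \<Rightarrow>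
     ('ob, 'mb, 'ob, 'mb) ftr \<Rightarrow> ('ob \<Rightarrow> 'ma) \<Rightarrow> 'oa \<Rightarrow> 'mb" where
  "lift_mate A B F \<phi> C S \<Omega> = (\<lambda>X. adj_inv B F \<phi> (OMap C X) (OMap S (OMap F X))
     (vcomp A (whisker_right \<Omega> F) (whisker_left C (adj_unit B F \<phi>)) X))"

definition lax_morphism ::
    "('oa, 'ma) cat \<Rightarrow> ('ob, 'mb) cat \<Rightarrow> ('oa, 'ma, 'ob, 'mb) ftr \<Rightarrow> ('ob, 'mb, 'oa, 'ma) ftr \<Rightarrow>
     ('oa \<Rightarrow> 'ob \<Rightarrow> 'mb \<Rightarrow> 'ma) \<Rightarrow> ('oa, 'ma, 'oa, 'ma) ftr \<Rightarrow>
     ('ob, 'mb, 'ob, 'mb) ftr \<Rightarrow> ('ob \<Rightarrow> 'ma) \<Rightarrow> 'ob \<Rightarrow> 'mb" where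
  "lax_morphism A B F U \<phi> C S \<Omega> =
     vcomp B (whisker_right (lift_mate A B F \<phi> C S \<Omega>) U) (whisker_left F (inv_trans A \<Omega>))"

end

theory Submission
  imports Defs
begin

text \<open>Under the transposition \<open>\<B>(FX,Y) \<cong> \<A>(X,UY)\<close> the Galois map becomes postcomposition with
  the natural isomorphism \<open>\<Phi> \<circ> \<Omega>\<inverse> : US \<rightarrow> UV\<close>, whose inverse is \<open>\<Omega> \<circ> \<Phi>\<inverse>\<close>. The transpose of
  \<open>\<chi>\<^sup>S\<close> at \<open>Y\<close> is \<open>\<Omega>\<^sub>T\<^sub>Y \<circ> C\<eta> \<circ> \<Omega>\<^sub>Y\<inverse>\<close>; postcomposing with \<open>\<Phi> \<circ> \<Omega>\<inverse>\<close> turns the first factor into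
  \<open>\<Phi>\<^sub>T\<^sub>Y\<close>, and \<open>\<Omega>\<inverse> = \<Phi>\<inverse> \<circ> (\<Phi> \<circ> \<Omega>\<inverse>)\<close> exhibits the result as the transpose of
  \<open>\<chi>\<^sup>V \<circ> F(\<Phi> \<circ> \<Omega>\<inverse>)\<close>.\<close>

section \<open>Inverse arrows\<close>

context category
begin

lemma hom_obj:
  assumes "f \<in> Hom C X Y"
  shows "X \<in> Obj C" "Y \<in> Obj C"
  using assms dom_obj cod_obj by (auto simp: Hom_def)

lemma inverse_arrows_hom:
  assumes "f \<in> Hom C X Y"
  shows "inverse_arrows C f g \<longleftrightarrow> g \<in> Hom C Y X \<and> g \<cdot> f = Ide C X \<and> f \<cdot> g = Ide C Y"
  using assms by (auto simp: inverse_arrows_def Hom_def)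

text \<open>Evaluating the triple composite \<open>g' f g\<close> with either bracketing identifies
  the two inverses. This is what gives the definite description in \<open>inv_arrow\<close> a
  meaning.\<close>

lemma inverse_arrows_unique:
  assumes "inverse_arrows C f g" "inverse_arrows C f g'"
  shows "g = g'"
proof -
  define X Y where "X = Dom C f" and "Y = Cod C f"
  have f: "f \<in> Hom C X Y"
    using assms(1) by (auto simp: inverse_arrows_def X_def Y_def Hom_def)
  have g: "g \<in> Hom C Y X" "f \<cdot> g = Ide C Y" and g': "g' \<in> Hom C Y X" "g' \<cdot> f = Ide C X"
    using assms by (simp_all add: inverse_arrows_hom[OF f])
  show ?thesis
    using comp_assoc[OF g(1) f g'(1)] by (simp add: g(2) g'(2) ide_left[OF g(1)] ide_right[OF g'(1)])
qed

lemma inverse_arrows_inv_arrow: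
  assumes "iso_arrow C f"
  shows "inverse_arrows C f (inv_arrow C f)"
proof -
  obtain g where g: "inverse_arrows C f g"
    using assms by (auto simp: iso_arrow_def)
  show ?thesis
    unfolding inv_arrow_def by (rule theI[where P = "inverse_arrows C f", OF g]) (rule inverse_arrows_unique[OF _ g])
qed

lemma
  assumes "f \<in> Hom C X Y" "iso_arrow C f"
  shows inv_arrow_hom: "inv_arrow C f \<in> Hom C Y X"
    and inv_arrow_left: "inv_arrow C f \<cdot> f = Ide C X"
    and inv_arrow_right: "f \<cdot> inv_arrow C f = Ide C Y"
  using inverse_arrows_inv_arrow[OF assms(2)] inverse_arrows_hom[OF assms(1)] by auto

text \<open>Cancellation with a trailing factor \<open>h\<close>: associativity is available only
  for typed factors, so one rule that removes an inverse inside a longer composite saves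
  rebracketing at each use.\<close>

lemma inv_arrow_left_cancel:
  assumes "f \<in> Hom C X Y" "iso_arrow C f" "h \<in> Hom C W X"
  shows "inv_arrow C f \<cdot> (f \<cdot> h) = h"
  using comp_assoc[OF assms(3,1) inv_arrow_hom[OF assms(1,2)]]
  by (simp add: inv_arrow_left[OF assms(1,2)] ide_left[OF assms(3)])

lemma inv_arrow_right_cancel:
  assumes "f \<in> Hom C X Y" "iso_arrow C f" "h \<in> Hom C W Y"
  shows "f \<cdot> (inv_arrow C f \<cdot> h) = h"
  using comp_assoc[OF assms(3) inv_arrow_hom[OF assms(1,2)] assms(1)]
  by (simp add: inv_arrow_right[OF assms(1,2)] ide_left[OF assms(3)])

end

section \<open>The hom-functors\<close>

lemma Hom_prod_op:
  "(f, g) \<in> Hom (prod_cat (op_cat A) B) (X, Y) (X', Y') \<longleftrightarrow> f \<in> Hom A X' X \<and> g \<in> Hom B Y Y'"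
  by (auto simp: Hom_def prod_cat_def op_cat_def)

lemma category_op_cat:
  assumes "category C"
  shows "category (op_cat C)"
proof -
  interpret category C by fact
  have [simp]: "Hom (op_cat C) X Y = Hom C Y X" for X Y
    by (auto simp: Hom_def op_cat_def)
  have [simp]: "Obj (op_cat C) = Obj C" "Arr (op_cat C) = Arr C" "Dom (op_cat C) = Cod C"
    "Cod (op_cat C) = Dom C" "Ide (op_cat C) = Ide C" "Comp (op_cat C) = (\<lambda>g f. f \<cdot>\<^bsub>C\<^esub> g)"
    by (simp_all add: op_cat_def)
  show ?thesis
    by unfold_locales
      (simp_all add: dom_obj cod_obj ide_hom ide_left ide_right comp_hom comp_assoc)
qed

lemma category_prod_cat:
  assumes "category A" "category B"
  shows "category (prod_cat A B)"
proof -
  interpret A: category A by fact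
  interpret B: category B by fact
  have [simp]: "Hom (prod_cat A B) P Q = Hom A (fst P) (fst Q) \<times> Hom B (snd P) (snd Q)" for P Q
    by (cases P, cases Q) (auto simp: Hom_def prod_cat_def)
  have [simp]: "Obj (prod_cat A B) = Obj A \<times> Obj B" "Arr (prod_cat A B) = Arr A \<times> Arr B"
    "Dom (prod_cat A B) = map_prod (Dom A) (Dom B)" "Cod (prod_cat A B) = map_prod (Cod A) (Cod B)"
    "Ide (prod_cat A B) = map_prod (Ide A) (Ide B)"
    "Comp (prod_cat A B) = (\<lambda>(g, g') (f, f'). (g \<cdot>\<^bsub>A\<^esub> f, g' \<cdot>\<^bsub>B\<^esub> f'))"
    by (simp_all add: prod_cat_def)
  show ?thesis
    by unfold_locales
      (auto simp: A.dom_obj A.cod_obj A.ide_hom A.ide_left A.ide_right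
        B.dom_obj B.cod_obj B.ide_hom B.ide_left B.ide_right
        intro: A.comp_hom B.comp_hom intro!: A.comp_assoc B.comp_assoc)
qed

lemma Hom_set_cat: "t \<in> Hom set_cat P Q \<longleftrightarrow> (\<exists>h \<in> P \<rightarrow>\<^sub>E Q. t = (P, h, Q))"
  by (auto simp: Hom_def set_cat_def)

lemma Comp_set_cat: "Comp set_cat (Q', k, R) (P, h, Q) = (P, compose P k h, R)"
  by (simp add: set_cat_def)

lemma Ide_set_cat: "Ide set_cat P = (P, \<lambda>x \<in> P. x, P)"
  by (simp add: set_cat_def)

text \<open>The unit laws rest on extensionality: the function of an arrow is
  \<open>undefined\<close> off its domain, so composing with a restricted identity returns the very
  same function and not merely one that agrees with it on the domain.\<close>

lemma category_set_cat: "category (set_cat :: ('a set, 'a set_arr) cat)"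
proof (unfold_locales, goal_cases)
  case (4 f X Y g Z)
  then show ?case
    by (auto simp: Hom_set_cat Comp_set_cat compose_def PiE_iff)
next
  case (5 f X Y)
  then show ?case
    by (auto simp: Hom_set_cat Comp_set_cat Ide_set_cat compose_def fun_eq_iff PiE_iff extensional_def)
next
  case (6 f X Y)
  then show ?case
    by (auto simp: Hom_set_cat Comp_set_cat Ide_set_cat compose_def fun_eq_iff PiE_iff extensional_def)
next
  case (7 f W X g Y h Z)
  then show ?case
    by (auto simp: Hom_set_cat Comp_set_cat compose_def fun_eq_iff)
qed (auto simp: set_cat_def Hom_def)

lemma OMap_hom_FS: "OMap (hom_FS B F S) (X, Y) = Hom B (OMap F X) (OMap S Y)"
  by (simp add: hom_FS_def comp_functor_def hom_functor_def prod_functor_def)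

text \<open>\<open>hom_functor\<close> reads its hom-sets off \<open>Dom\<close> and
  \<open>Cod\<close> of the given arrows; the typing hypotheses turn these into named objects. The
  first variable is contravariant, hence the direction of \<open>f\<close>.\<close>

lemma AMap_hom_FS:
  assumes "is_functor A B F" "is_functor B B S" "f \<in> Hom A X' X" "g \<in> Hom B Y Y'"
  shows "AMap (hom_FS B F S) (f, g) =
    (Hom B (OMap F X) (OMap S Y),
     \<lambda>h \<in> Hom B (OMap F X) (OMap S Y). AMap S g \<cdot>\<^bsub>B\<^esub> (h \<cdot>\<^bsub>B\<^esub> AMap F f),
     Hom B (OMap F X') (OMap S Y'))"
proof -
  have "AMap F f \<in> Hom B (OMap F X') (OMap F X)" "AMap S g \<in> Hom B (OMap S Y) (OMap S Y')"
    using assms is_functor.amap_hom by metis+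
  then show ?thesis
    by (auto simp: hom_FS_def comp_functor_def hom_functor_def prod_functor_def Hom_def)
qed

text \<open>The locale \<open>nat_trans\<close> includes functoriality of its source and target, so
  this must be known before the Galois map can be shown to be natural.\<close>

lemma is_functor_hom_FS:
  assumes "is_functor A B F" "is_functor B B S"
  shows "is_functor (prod_cat (op_cat A) B) set_cat (hom_FS B F S)"
proof -
  interpret F: is_functor A B F by fact
  interpret S: is_functor B B S by fact
  interpret P: category "prod_cat (op_cat A) B"
    by (intro category_prod_cat category_op_cat F.A.category_axioms F.B.category_axioms)
  interpret Set: category set_cat
    by (rule category_set_cat)
  note amap = AMap_hom_FS[OF assms]
  show ?thesis
  proof (unfold_locales, goal_cases)
    case (1 P)
    then show ?case by (simp add: set_cat_def)
  next
    case (2 p P Q)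
    obtain f g X Y X' Y' where eq: "p = (f, g)" "P = (X, Y)" "Q = (X', Y')"
      by (metis surj_pair)
    have f: "f \<in> Hom A X' X" and g: "g \<in> Hom B Y Y'"
      using 2 by (auto simp: eq Hom_prod_op)
    show ?case
      unfolding eq amap[OF f g] Hom_set_cat OMap_hom_FS
      using F.amap_hom[OF f] S.amap_hom[OF g] by (auto intro!: F.B.comp_hom)
  next
    case (3 P)
    obtain X Y where eq: "P = (X, Y)"
      by (metis surj_pair)
    have X: "X \<in> Obj A" and Y: "Y \<in> Obj B"
      using 3 by (auto simp: eq prod_cat_def op_cat_def)
    have "Ide (prod_cat (op_cat A) B) P = (Ide A X, Ide B Y)"
      by (simp add: eq prod_cat_def op_cat_def)
    moreover have "Ide B (OMap S Y) \<cdot>\<^bsub>B\<^esub> (h \<cdot>\<^bsub>B\<^esub> Ide B (OMap F X)) = h"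
      if "h \<in> Hom B (OMap F X) (OMap S Y)" for h
      using that by (simp add: F.B.ide_right F.B.ide_left)
    ultimately show ?case
      using amap[OF F.A.ide_hom[OF X] F.B.ide_hom[OF Y]]
      by (auto simp: eq OMap_hom_FS set_cat_def F.amap_ide[OF X] S.amap_ide[OF Y]
          intro!: restrict_ext)
  next
    case (4 p P Q q R)
    obtain f g X Y X' Y' f' g' X'' Y'' where
      eq: "p = (f, g)" "P = (X, Y)" "Q = (X', Y')" "q = (f', g')" "R = (X'', Y'')"
      by (metis surj_pair)
    have hom: "f \<in> Hom A X' X" "g \<in> Hom B Y Y'" "f' \<in> Hom A X'' X'" "g' \<in> Hom B Y' Y''"
      using 4 by (auto simp: eq Hom_prod_op)
    note h = F.amap_hom[OF hom(1)] S.amap_hom[OF hom(2)] F.amap_hom[OF hom(3)]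
      S.amap_hom[OF hom(4)]
    have "Comp (prod_cat (op_cat A) B) q p = (f \<cdot>\<^bsub>A\<^esub> f', g' \<cdot>\<^bsub>B\<^esub> g)"
      by (simp add: eq prod_cat_def op_cat_def)
    \<comment> \<open>Once \<open>F\<close> and \<open>S\<close> are distributed over composites,
      preservation of composition is this rebracketing around \<open>k\<close>.\<close>
    moreover have "(AMap S g' \<cdot>\<^bsub>B\<^esub> AMap S g) \<cdot>\<^bsub>B\<^esub> (k \<cdot>\<^bsub>B\<^esub> (AMap F f \<cdot>\<^bsub>B\<^esub> AMap F f')) =
        AMap S g' \<cdot>\<^bsub>B\<^esub> ((AMap S g \<cdot>\<^bsub>B\<^esub> (k \<cdot>\<^bsub>B\<^esub> AMap F f)) \<cdot>\<^bsub>B\<^esub> AMap F f')"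
      if k: "k \<in> Hom B (OMap F X) (OMap S Y)" for k
    proof -
      have kf: "k \<cdot>\<^bsub>B\<^esub> AMap F f \<in> Hom B (OMap F X') (OMap S Y)"
        by (rule F.B.comp_hom[OF h(1) k])
      show ?thesis
        using F.B.comp_assoc[OF F.B.comp_hom[OF h(3) kf] h(2,4)] F.B.comp_assoc[OF h(3) kf h(2)]
          F.B.comp_assoc[OF h(3,1) k] by simp
    qed
    moreover have "AMap S g \<cdot>\<^bsub>B\<^esub> (k \<cdot>\<^bsub>B\<^esub> AMap F f) \<in> Hom B (OMap F X') (OMap S Y')"
      if "k \<in> Hom B (OMap F X) (OMap S Y)" for k
      using F.B.comp_hom[OF F.B.comp_hom[OF h(1) that] h(2)] .
    ultimately show ?case
      using hom F.A.comp_hom[OF hom(3,1)] F.B.comp_hom[OF hom(2,4)]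
      by (auto simp: eq amap Comp_set_cat compose_def fun_eq_iff
          F.amap_comp[OF hom(3,1)] S.amap_comp[OF hom(2,4)])
  qed
qed

section \<open>Transposition across an adjunction\<close>

context adjunction
begin

abbreviation \<psi> where "\<psi> \<equiv> adj_inv B F \<phi>"

lemma \<phi>_hom:
  assumes "X \<in> Obj A" "Y \<in> Obj B" "f \<in> Hom B (OMap F X) Y"
  shows "\<phi> X Y f \<in> Hom A X (OMap U Y)"
  using bij_betwE[OF \<phi>_bij] assms by blast

lemma \<psi>_hom:
  assumes "X \<in> Obj A" "Y \<in> Obj B" "g \<in> Hom A X (OMap U Y)"
  shows "\<psi> X Y g \<in> Hom B (OMap F X) Y"
  using bij_betw_inv_into[OF \<phi>_bij] assms bij_betwE unfolding adj_inv_def by blast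

lemma \<phi>_\<psi>:
  assumes "X \<in> Obj A" "Y \<in> Obj B" "g \<in> Hom A X (OMap U Y)"
  shows "\<phi> X Y (\<psi> X Y g) = g"
  unfolding adj_inv_def using bij_betw_inv_into_right[OF \<phi>_bij] assms by blast

lemma \<psi>_\<phi>:
  assumes "X \<in> Obj A" "Y \<in> Obj B" "f \<in> Hom B (OMap F X) Y"
  shows "\<psi> X Y (\<phi> X Y f) = f"
  unfolding adj_inv_def using bij_betw_inv_into_left[OF \<phi>_bij] assms by blast

text \<open>Naturality of \<phi> with the identity of \<open>Y\<close> in the second
  variable.\<close>

lemma \<phi>_precomp:
  assumes "Y \<in> Obj B" "f \<in> Hom A X' X" "h \<in> Hom B (OMap F X) Y"
  shows "\<phi> X' Y (h \<cdot>\<^bsub>B\<^esub> AMap F f) = \<phi> X Y h \<cdot>\<^bsub>A\<^esub> f"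
proof -
  have X: "X \<in> Obj A"
    using assms F.A.hom_obj by blast
  have "\<phi> X Y h \<cdot>\<^bsub>A\<^esub> f \<in> Hom A X' (OMap U Y)"
    using \<phi>_hom[OF X assms(1,3)] assms(2) F.A.comp_hom by blast
  moreover have "h \<cdot>\<^bsub>B\<^esub> AMap F f \<in> Hom B (OMap F X') Y"
    using assms F.amap_hom F.B.comp_hom by blast
  ultimately show ?thesis
    using \<phi>_natural[OF assms(2,3) F.B.ide_hom[OF assms(1)]] U.amap_ide[OF assms(1)]
    by (metis F.A.ide_left F.B.ide_left)
qed

text \<open>Naturality of \<phi> with the identity of \<open>X\<close> in the first
  variable.\<close>

lemma \<phi>_postcomp:
  assumes "X \<in> Obj A" "h \<in> Hom B (OMap F X) Y" "g \<in> Hom B Y Y'"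
  shows "\<phi> X Y' (g \<cdot>\<^bsub>B\<^esub> h) = AMap U g \<cdot>\<^bsub>A\<^esub> \<phi> X Y h"
proof -
  have "\<phi> X Y h \<in> Hom A X (OMap U Y)"
    using \<phi>_hom assms F.B.hom_obj by blast
  then show ?thesis
    using \<phi>_natural[OF F.A.ide_hom[OF assms(1)] assms(2,3)] F.amap_ide[OF assms(1)] assms(2)
    by (metis F.A.ide_right F.B.ide_right)
qed

text \<open>Naturality of \<phi> is used at the arrow \<open>\<psi> X Y h\<close>; applying \<psi>
  to both sides then transfers it to the inverse bijection.\<close>

lemma \<psi>_natural:
  assumes "f \<in> Hom A X' X" "h \<in> Hom A X (OMap U Y)" "g \<in> Hom B Y Y'"
  shows "\<psi> X' Y' (AMap U g \<cdot>\<^bsub>A\<^esub> (h \<cdot>\<^bsub>A\<^esub> f)) = g \<cdot>\<^bsub>B\<^esub> (\<psi> X Y h \<cdot>\<^bsub>B\<^esub> AMap F f)"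
proof -
  have X: "X' \<in> Obj A" "X \<in> Obj A" and Y: "Y \<in> Obj B" "Y' \<in> Obj B"
    using assms F.A.hom_obj F.B.hom_obj by blast+
  note h = \<psi>_hom[OF X(2) Y(1) assms(2)]
  have "g \<cdot>\<^bsub>B\<^esub> (\<psi> X Y h \<cdot>\<^bsub>B\<^esub> AMap F f) \<in> Hom B (OMap F X') Y'"
    using h assms F.amap_hom F.B.comp_hom by metis
  then show ?thesis
    using \<phi>_natural[OF assms(1) h assms(3)] \<psi>_\<phi>[OF X(1) Y(2)] \<phi>_\<psi>[OF X(2) Y(1) assms(2)]
    by metis
qed

lemma unit_hom:
  assumes "X \<in> Obj A"
  shows "adj_unit B F \<phi> X \<in> Hom A X (OMap U (OMap F X))"
  unfolding adj_unit_def using assms F.omap_obj by (intro \<phi>_hom F.B.ide_hom) auto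

text \<open>The Yoneda argument: \<open>f\<close> is itself composed with the identity of
  \<open>FX\<close>, and the transpose of that identity is the unit.\<close>

lemma \<phi>_eq_unit:
  assumes "X \<in> Obj A" "f \<in> Hom B (OMap F X) Y"
  shows "\<phi> X Y f = AMap U f \<cdot>\<^bsub>A\<^esub> adj_unit B F \<phi> X"
  unfolding adj_unit_def
  using \<phi>_postcomp[OF assms(1) F.B.ide_hom[OF F.omap_obj[OF assms(1)]] assms(2)]
    F.B.ide_right[OF assms(2)] by simp

lemma counit_hom:
  assumes "Y \<in> Obj B"
  shows "adj_counit A B F U \<phi> Y \<in> Hom B (OMap F (OMap U Y)) Y"
  unfolding adj_counit_def using assms U.omap_obj by (intro \<psi>_hom F.A.ide_hom) auto

text \<open>By \<open>\<phi>_precomp\<close> the right-hand side has transpose \<open>g\<close>,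
  because the counit transposes to an identity; applying \<psi> finishes.\<close>

lemma \<psi>_eq_counit:
  assumes "Y \<in> Obj B" "g \<in> Hom A X (OMap U Y)"
  shows "\<psi> X Y g = adj_counit A B F U \<phi> Y \<cdot>\<^bsub>B\<^esub> AMap F g"
proof -
  have X: "X \<in> Obj A" and UY: "OMap U Y \<in> Obj A"
    using assms F.A.hom_obj by blast+
  note \<epsilon> = counit_hom[OF assms(1)]
  have "\<phi> X Y (adj_counit A B F U \<phi> Y \<cdot>\<^bsub>B\<^esub> AMap F g) = Ide A (OMap U Y) \<cdot>\<^bsub>A\<^esub> g"
    unfolding \<phi>_precomp[OF assms(1,2) \<epsilon>]
    by (simp add: adj_counit_def \<phi>_\<psi>[OF UY assms(1) F.A.ide_hom[OF UY]])
  also have "\<dots> = g"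
    using F.A.ide_left[OF assms(2)] .
  finally show ?thesis
    using \<psi>_\<phi>[OF X assms(1)] F.B.comp_hom[OF F.amap_hom[OF assms(2)] \<epsilon>] by metis
qed

end

section \<open>Lifts\<close>

text \<open>A single lift is treated here so that the locale can be instantiated twice over the same
  adjunction and the same \<open>C\<close>; all facts about \<Omega> then hold for \<Phi> as
  well.\<close>

locale lift_through_adjunction = adjunction A B F U \<phi> + C: is_functor A A C
  for A :: "('oa, 'ma) cat" and B :: "('ob, 'mb) cat"
    and F :: "('oa, 'ma, 'ob, 'mb) ftr" and U :: "('ob, 'mb, 'oa, 'ma) ftr"
    and \<phi> :: "'oa \<Rightarrow> 'ob \<Rightarrow> 'mb \<Rightarrow> 'ma" and C :: "('oa, 'ma, 'oa, 'ma) ftr" +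
  fixes S :: "('ob, 'mb, 'ob, 'mb) ftr" and \<Omega> :: "'ob \<Rightarrow> 'ma"
  assumes lift: "is_lift A B U C S \<Omega>"
begin

sublocale S: is_functor B B S
  using lift by (simp add: is_lift_def)

sublocale \<Omega>: nat_iso B A "C \<odot> U" "U \<odot> S" \<Omega>
  using lift by (simp add: is_lift_def)

lemma \<Omega>_hom: "Y \<in> Obj B \<Longrightarrow> \<Omega> Y \<in> Hom A (OMap C (OMap U Y)) (OMap U (OMap S Y))"
  using \<Omega>.component_hom by (simp add: comp_functor_def)

lemma \<Omega>_inv_hom:
  "Y \<in> Obj B \<Longrightarrow> inv_arrow A (\<Omega> Y) \<in> Hom A (OMap U (OMap S Y)) (OMap C (OMap U Y))"
  by (intro F.A.inv_arrow_hom \<Omega>_hom \<Omega>.component_iso)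

lemma \<Omega>_natural:
  "g \<in> Hom B Y Y' \<Longrightarrow> AMap U (AMap S g) \<cdot>\<^bsub>A\<^esub> \<Omega> Y = \<Omega> Y' \<cdot>\<^bsub>A\<^esub> AMap C (AMap U g)"
  using \<Omega>.naturality by (simp add: comp_functor_def)

text \<open>The naturality square of \<Omega> is composed with the inverse components on both
  sides.\<close>

lemma \<Omega>_inv_natural:
  assumes "g \<in> Hom B Y Y'"
  shows "AMap C (AMap U g) \<cdot>\<^bsub>A\<^esub> inv_arrow A (\<Omega> Y) =
    inv_arrow A (\<Omega> Y') \<cdot>\<^bsub>A\<^esub> AMap U (AMap S g)"
proof -
  have Y: "Y \<in> Obj B" "Y' \<in> Obj B"
    using assms F.B.hom_obj by blast+
  have hom: "AMap C (AMap U g) \<in> Hom A (OMap C (OMap U Y)) (OMap C (OMap U Y'))"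
    "AMap U (AMap S g) \<in> Hom A (OMap U (OMap S Y)) (OMap U (OMap S Y'))"
    using assms C.amap_hom U.amap_hom S.amap_hom by blast+
  note \<Omega> = \<Omega>_hom[OF Y(1)] \<Omega>_hom[OF Y(2)] \<Omega>_inv_hom[OF Y(1)] \<Omega>_inv_hom[OF Y(2)]
  \<comment> \<open>The pair \<open>inv_arrow A (\<Omega> Y')\<close>, \<open>\<Omega> Y'\<close> is
    inserted on the left, so that the naturality square of \<Omega> can be applied inside the
    bracket.\<close>
  have "AMap C (AMap U g) \<cdot>\<^bsub>A\<^esub> inv_arrow A (\<Omega> Y) =
      inv_arrow A (\<Omega> Y') \<cdot>\<^bsub>A\<^esub> ((\<Omega> Y' \<cdot>\<^bsub>A\<^esub> AMap C (AMap U g)) \<cdot>\<^bsub>A\<^esub> inv_arrow A (\<Omega> Y))"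
    using F.A.inv_arrow_left_cancel[OF \<Omega>(2) \<Omega>.component_iso[OF Y(2)]
        F.A.comp_hom[OF \<Omega>(3) hom(1)]] F.A.comp_assoc[OF \<Omega>(3) hom(1) \<Omega>(2)] by simp
  also have "\<dots> = inv_arrow A (\<Omega> Y') \<cdot>\<^bsub>A\<^esub>
      (AMap U (AMap S g) \<cdot>\<^bsub>A\<^esub> (\<Omega> Y \<cdot>\<^bsub>A\<^esub> inv_arrow A (\<Omega> Y)))"
    using \<Omega>_natural[OF assms] F.A.comp_assoc[OF \<Omega>(3,1) hom(2)] by simp
  also have "\<dots> = inv_arrow A (\<Omega> Y') \<cdot>\<^bsub>A\<^esub> AMap U (AMap S g)"
    using F.A.inv_arrow_right[OF \<Omega>(1) \<Omega>.component_iso[OF Y(1)]] F.A.ide_right[OF hom(2)] by simp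
  finally show ?thesis .
qed

text \<open>The mate is a \<psi>-image by definition, so everything reduces to typing the arrow
  being transposed.\<close>

lemma
  assumes "X \<in> Obj A"
  shows lift_mate_hom:
      "lift_mate A B F \<phi> C S \<Omega> X \<in> Hom B (OMap F (OMap C X)) (OMap S (OMap F X))" (is ?hom)
    and \<phi>_lift_mate: "\<phi> (OMap C X) (OMap S (OMap F X)) (lift_mate A B F \<phi> C S \<Omega> X) =
      \<Omega> (OMap F X) \<cdot>\<^bsub>A\<^esub> AMap C (adj_unit B F \<phi> X)" (is ?eq)
proof -
  have "\<Omega> (OMap F X) \<cdot>\<^bsub>A\<^esub> AMap C (adj_unit B F \<phi> X) \<in>
      Hom A (OMap C X) (OMap U (OMap S (OMap F X)))"
    using \<Omega>_hom[OF F.omap_obj[OF assms]] C.amap_hom[OF unit_hom[OF assms]] F.A.comp_hom by blast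
  then show ?hom ?eq
    using assms F.omap_obj C.omap_obj S.omap_obj
    by (auto simp: lift_mate_def vcomp_def whisker_left_def whisker_right_def intro!: \<psi>_hom \<phi>_\<psi>)
qed

text \<open>Transposition turns precomposition with F\<Omega>\<inverse> into precomposition with
  \<Omega>\<inverse>, leaving the known transpose of \<Lambda>. The comparison of the two lax
  morphisms uses this formula in \<open>A\<close>.\<close>

lemma
  assumes "Y \<in> Obj B"
  shows lax_morphism_hom: "lax_morphism A B F U \<phi> C S \<Omega> Y \<in>
        Hom B (OMap F (OMap U (OMap S Y))) (OMap S (OMap F (OMap U Y)))" (is ?hom)
    and \<phi>_lax_morphism: "\<phi> (OMap U (OMap S Y)) (OMap S (OMap F (OMap U Y)))
        (lax_morphism A B F U \<phi> C S \<Omega> Y) =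
      \<Omega> (OMap F (OMap U Y)) \<cdot>\<^bsub>A\<^esub>
        (AMap C (adj_unit B F \<phi> (OMap U Y)) \<cdot>\<^bsub>A\<^esub> inv_arrow A (\<Omega> Y))" (is ?eq)
proof -
  have UY: "OMap U Y \<in> Obj A" "OMap F (OMap U Y) \<in> Obj B"
    using assms U.omap_obj F.omap_obj by blast+
  have lax: "lax_morphism A B F U \<phi> C S \<Omega> Y =
      lift_mate A B F \<phi> C S \<Omega> (OMap U Y) \<cdot>\<^bsub>B\<^esub> AMap F (inv_arrow A (\<Omega> Y))"
    by (simp add: lax_morphism_def vcomp_def whisker_left_def whisker_right_def inv_trans_def)
  note hom = lift_mate_hom[OF UY(1)] \<Omega>_inv_hom[OF assms]
  show ?hom
    unfolding lax using hom F.amap_hom F.B.comp_hom by blast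
  show ?eq
    unfolding lax \<phi>_precomp[OF S.omap_obj[OF UY(2)] hom(2,1)] \<phi>_lift_mate[OF UY(1)]
    by (rule F.A.comp_assoc[OF hom(2) C.amap_hom[OF unit_hom[OF UY(1)]] \<Omega>_hom[OF UY(2)]])
qed

end

section \<open>Comparison of two lifts, and the Galois map on single arrows\<close>

locale two_lifts =
  S: lift_through_adjunction A B F U \<phi> C S \<Omega> + V: lift_through_adjunction A B F U \<phi> C V \<Phi>
  for A :: "('oa, 'ma) cat" and B :: "('ob, 'mb) cat" and F U \<phi> C S \<Omega> V \<Phi>
begin

abbreviation \<psi> where "\<psi> \<equiv> adj_inv B F \<phi>"
abbreviation \<delta> where "\<delta> \<equiv> lift_compare A \<Omega> \<Phi>"

lemma lift_compare_eq: "\<delta> Y = \<Phi> Y \<cdot>\<^bsub>A\<^esub> inv_arrow A (\<Omega> Y)"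
  by (simp add: lift_compare_def vcomp_def inv_trans_def)

lemma lift_compare_hom: "Y \<in> Obj B \<Longrightarrow> \<delta> Y \<in> Hom A (OMap U (OMap S Y)) (OMap U (OMap V Y))"
  unfolding lift_compare_eq by (rule S.F.A.comp_hom[OF S.\<Omega>_inv_hom V.\<Omega>_hom])

text \<open>The inner pair \<Omega>\<inverse>\<Omega> cancels. This is the exchange of \<Omega> for
  \<Phi> in the transpose of \<open>\<chi>\<^sup>S\<close>.\<close>

lemma lift_compare_comp_lift:
  assumes "Y \<in> Obj B" "h \<in> Hom A W (OMap C (OMap U Y))"
  shows "\<delta> Y \<cdot>\<^bsub>A\<^esub> (\<Omega> Y \<cdot>\<^bsub>A\<^esub> h) = \<Phi> Y \<cdot>\<^bsub>A\<^esub> h"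
proof -
  note \<Omega> = S.\<Omega>_hom[OF assms(1)] S.\<Omega>_inv_hom[OF assms(1)] V.\<Omega>_hom[OF assms(1)]
  show ?thesis
    unfolding lift_compare_eq
    using S.F.A.comp_assoc[OF S.F.A.comp_hom[OF assms(2) \<Omega>(1)] \<Omega>(2,3)]
      S.F.A.inv_arrow_left_cancel[OF \<Omega>(1) S.\<Omega>.component_iso[OF assms(1)] assms(2)] by simp
qed

text \<open>Here \<Phi>\<inverse>\<Phi> cancels. Read from right to left, it splits off \<delta> as
  a right factor of \<Omega>\<inverse>.\<close>

lemma inv_lift_comp_lift_compare:
  assumes "Y \<in> Obj B"
  shows "inv_arrow A (\<Phi> Y) \<cdot>\<^bsub>A\<^esub> \<delta> Y = inv_arrow A (\<Omega> Y)"
  unfolding lift_compare_eq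
  by (rule S.F.A.inv_arrow_left_cancel[OF V.\<Omega>_hom[OF assms] V.\<Omega>.component_iso[OF assms]
        S.\<Omega>_inv_hom[OF assms]])

lemma lift_compare_inverse:
  assumes "Y \<in> Obj B" "h \<in> Hom A W (OMap U (OMap S Y))"
  shows "lift_compare A \<Phi> \<Omega> Y \<cdot>\<^bsub>A\<^esub> (\<delta> Y \<cdot>\<^bsub>A\<^esub> h) = h"
proof -
  note \<Omega> = S.\<Omega>_hom[OF assms(1)] S.\<Omega>_inv_hom[OF assms(1)] V.\<Omega>_inv_hom[OF assms(1)]
  note \<delta> = lift_compare_hom[OF assms(1)]
  have "lift_compare A \<Phi> \<Omega> Y \<cdot>\<^bsub>A\<^esub> (\<delta> Y \<cdot>\<^bsub>A\<^esub> h) =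
      \<Omega> Y \<cdot>\<^bsub>A\<^esub> (inv_arrow A (\<Phi> Y) \<cdot>\<^bsub>A\<^esub> (\<delta> Y \<cdot>\<^bsub>A\<^esub> h))"
    using S.F.A.comp_assoc[OF S.F.A.comp_hom[OF assms(2) \<delta>] \<Omega>(3,1)]
    by (simp add: lift_compare_def vcomp_def inv_trans_def)
  also have "\<dots> = \<Omega> Y \<cdot>\<^bsub>A\<^esub> (inv_arrow A (\<Omega> Y) \<cdot>\<^bsub>A\<^esub> h)"
    using S.F.A.comp_assoc[OF assms(2) \<delta> \<Omega>(3)] inv_lift_comp_lift_compare[OF assms(1)] by simp
  also have "\<dots> = h"
    by (rule S.F.A.inv_arrow_right_cancel[OF \<Omega>(1) S.\<Omega>.component_iso[OF assms(1)] assms(2)])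
  finally show ?thesis .
qed

text \<open>The naturality squares of \<Omega>\<inverse> and \<Phi> are pasted along
  \<open>AMap C (AMap U g)\<close>.\<close>

lemma lift_compare_natural:
  assumes "g \<in> Hom B Y Y'"
  shows "AMap U (AMap V g) \<cdot>\<^bsub>A\<^esub> \<delta> Y = \<delta> Y' \<cdot>\<^bsub>A\<^esub> AMap U (AMap S g)"
proof -
  have Y: "Y \<in> Obj B" "Y' \<in> Obj B"
    using assms S.F.B.hom_obj by blast+
  have hom: "AMap C (AMap U g) \<in> Hom A (OMap C (OMap U Y)) (OMap C (OMap U Y'))"
    "AMap U (AMap S g) \<in> Hom A (OMap U (OMap S Y)) (OMap U (OMap S Y'))"
    "AMap U (AMap V g) \<in> Hom A (OMap U (OMap V Y)) (OMap U (OMap V Y'))"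
    using assms S.C.amap_hom S.U.amap_hom S.S.amap_hom V.S.amap_hom by blast+
  note \<Omega> = S.\<Omega>_inv_hom[OF Y(1)] S.\<Omega>_inv_hom[OF Y(2)] V.\<Omega>_hom[OF Y(1)] V.\<Omega>_hom[OF Y(2)]
  show ?thesis
    unfolding lift_compare_eq
    using S.F.A.comp_assoc[OF \<Omega>(1,3) hom(3)] S.F.A.comp_assoc[OF \<Omega>(1) hom(1) \<Omega>(4)]
      S.F.A.comp_assoc[OF hom(2) \<Omega>(2,4)] V.\<Omega>_natural[OF assms] S.\<Omega>_inv_natural[OF assms]
    by simp
qed

text \<open>The function underlying \<open>galois_map\<close> before restriction to the hom-set, so
  that equations can be proved without carrying \<open>restrict\<close> along.\<close>

definition galois where "galois X Y f = \<psi> X (OMap V Y) (\<delta> Y \<cdot>\<^bsub>A\<^esub> \<phi> X (OMap S Y) f)"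

lemma galois_map_eq: "galois_map A B F \<phi> S \<Omega> V \<Phi> (X, Y) =
    (Hom B (OMap F X) (OMap S Y), restrict (galois X Y) (Hom B (OMap F X) (OMap S Y)),
     Hom B (OMap F X) (OMap V Y))"
  by (simp add: galois_map_def galois_def[abs_def])

text \<open>The third claim is the working description: after transposition, the Galois map is
  postcomposition with \<delta>.\<close>

lemma
  assumes "X \<in> Obj A" "Y \<in> Obj B" "f \<in> Hom B (OMap F X) (OMap S Y)"
  shows transpose_hom: "\<delta> Y \<cdot>\<^bsub>A\<^esub> \<phi> X (OMap S Y) f \<in> Hom A X (OMap U (OMap V Y))"
    and galois_hom: "galois X Y f \<in> Hom B (OMap F X) (OMap V Y)"
    and \<phi>_galois: "\<phi> X (OMap V Y) (galois X Y f) = \<delta> Y \<cdot>\<^bsub>A\<^esub> \<phi> X (OMap S Y) f"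
proof -
  show *: "\<delta> Y \<cdot>\<^bsub>A\<^esub> \<phi> X (OMap S Y) f \<in> Hom A X (OMap U (OMap V Y))"
    using lift_compare_hom[OF assms(2)] S.\<phi>_hom[OF assms(1) S.S.omap_obj[OF assms(2)] assms(3)]
      S.F.A.comp_hom by blast
  show "galois X Y f \<in> Hom B (OMap F X) (OMap V Y)"
    "\<phi> X (OMap V Y) (galois X Y f) = \<delta> Y \<cdot>\<^bsub>A\<^esub> \<phi> X (OMap S Y) f"
    unfolding galois_def
    using S.\<psi>_hom[OF assms(1) V.S.omap_obj[OF assms(2)] *]
      S.\<phi>_\<psi>[OF assms(1) V.S.omap_obj[OF assms(2)] *] by simp_all
qed

text \<open>On transposes the claim says that \<delta> commutes past
  \<open>AMap U (AMap S g)\<close>, which is naturality of \<delta>; \<open>\<psi>_natural\<close>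
  carries the result back to \<open>B\<close>.\<close>

lemma galois_natural:
  assumes "f \<in> Hom A X' X" "g \<in> Hom B Y Y'" "h \<in> Hom B (OMap F X) (OMap S Y)"
  shows "galois X' Y' (AMap S g \<cdot>\<^bsub>B\<^esub> (h \<cdot>\<^bsub>B\<^esub> AMap F f)) =
    AMap V g \<cdot>\<^bsub>B\<^esub> (galois X Y h \<cdot>\<^bsub>B\<^esub> AMap F f)"
proof -
  have X: "X \<in> Obj A" "X' \<in> Obj A" and Y: "Y \<in> Obj B" "Y' \<in> Obj B"
    using assms S.F.A.hom_obj S.F.B.hom_obj by blast+
  let ?h = "\<phi> X (OMap S Y) h"
  note hom = S.\<phi>_hom[OF X(1) S.S.omap_obj[OF Y(1)] assms(3)]
    lift_compare_hom[OF Y(1)] lift_compare_hom[OF Y(2)]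
    S.U.amap_hom[OF S.S.amap_hom[OF assms(2)]] S.U.amap_hom[OF V.S.amap_hom[OF assms(2)]]
  note hf = S.F.A.comp_hom[OF assms(1) hom(1)]
  have "\<delta> Y' \<cdot>\<^bsub>A\<^esub> \<phi> X' (OMap S Y') (AMap S g \<cdot>\<^bsub>B\<^esub> (h \<cdot>\<^bsub>B\<^esub> AMap F f)) =
      \<delta> Y' \<cdot>\<^bsub>A\<^esub> (AMap U (AMap S g) \<cdot>\<^bsub>A\<^esub> (?h \<cdot>\<^bsub>A\<^esub> f))"
    by (simp add: S.\<phi>_natural[OF assms(1,3) S.S.amap_hom[OF assms(2)]])
  also have "\<dots> = AMap U (AMap V g) \<cdot>\<^bsub>A\<^esub> ((\<delta> Y \<cdot>\<^bsub>A\<^esub> ?h) \<cdot>\<^bsub>A\<^esub> f)"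
    using S.F.A.comp_assoc[OF hf hom(4,3)] S.F.A.comp_assoc[OF hf hom(2,5)]
      S.F.A.comp_assoc[OF assms(1) hom(1,2)] lift_compare_natural[OF assms(2)] by simp
  finally show ?thesis
    unfolding galois_def
    using S.\<psi>_natural[OF assms(1) transpose_hom[OF X(1) Y(1) assms(3)] V.S.amap_hom[OF assms(2)]]
    by simp
qed

text \<open>The two adjunction bijections are replaced by their unit and counit formulas, and
  \<open>F\<close> is distributed over the resulting composite.\<close>

lemma galois_eq_composite:
  assumes "X \<in> Obj A" "Y \<in> Obj B" "f \<in> Hom B (OMap F X) (OMap S Y)"
  shows "galois X Y f = adj_counit A B F U \<phi> (OMap V Y) \<cdot>\<^bsub>B\<^esub>
    (AMap F (\<delta> Y) \<cdot>\<^bsub>B\<^esub> (AMap F (AMap U f) \<cdot>\<^bsub>B\<^esub> AMap F (adj_unit B F \<phi> X)))"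
proof -
  note hom = S.unit_hom[OF assms(1)] S.U.amap_hom[OF assms(3)] lift_compare_hom[OF assms(2)]
  show ?thesis
    unfolding galois_def S.\<psi>_eq_counit[OF V.S.omap_obj[OF assms(2)] transpose_hom[OF assms]]
    unfolding S.\<phi>_eq_unit[OF assms(1,3)] S.F.amap_comp[OF S.F.A.comp_hom[OF hom(1,2)] hom(3)]
      S.F.amap_comp[OF hom(1,2)] ..
qed

text \<open>Both sides are compared through their transposes. The comparison \<delta> enters at two
  objects: at \<open>TY\<close> after the transpose of \<open>\<chi>\<^sup>S\<close>, and at
  \<open>Y\<close> before the transpose of \<open>\<chi>\<^sup>V\<close>.\<close>

lemma galois_lax_morphism:
  assumes "Y \<in> Obj B"
  shows "galois (OMap U (OMap S Y)) (OMap F (OMap U Y)) (lax_morphism A B F U \<phi> C S \<Omega> Y) =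
    lax_morphism A B F U \<phi> C V \<Phi> Y \<cdot>\<^bsub>B\<^esub> AMap F (\<delta> Y)"
proof -
  let ?X = "OMap U (OMap S Y)" and ?T = "OMap F (OMap U Y)"
  let ?C\<eta> = "AMap C (adj_unit B F \<phi> (OMap U Y))"
  have obj: "?X \<in> Obj A" "OMap U Y \<in> Obj A" "?T \<in> Obj B" "OMap V ?T \<in> Obj B"
    using assms S.U.omap_obj S.F.omap_obj S.S.omap_obj V.S.omap_obj by metis+
  note C\<eta> = S.C.amap_hom[OF S.unit_hom[OF obj(2)]]
  note \<delta> = lift_compare_hom[OF assms]
  note \<Omega>' = S.\<Omega>_inv_hom[OF assms] and \<Phi>' = V.\<Omega>_inv_hom[OF assms]
  note C\<eta>\<Phi>' = S.F.A.comp_hom[OF \<Phi>' C\<eta>]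
  have "\<delta> ?T \<cdot>\<^bsub>A\<^esub> \<phi> ?X (OMap S ?T) (lax_morphism A B F U \<phi> C S \<Omega> Y) =
      \<Phi> ?T \<cdot>\<^bsub>A\<^esub> (?C\<eta> \<cdot>\<^bsub>A\<^esub> inv_arrow A (\<Omega> Y))"
    unfolding S.\<phi>_lax_morphism[OF assms]
    by (rule lift_compare_comp_lift[OF obj(3) S.F.A.comp_hom[OF \<Omega>' C\<eta>]])
  \<comment> \<open>The remaining \<Omega>\<inverse> at \<open>Y\<close> is rewritten as
    \<Phi>\<inverse> after \<delta>, which makes the transpose of \<open>\<chi>\<^sup>V\<close>
    visible.\<close>
  also have "\<dots> = (\<Phi> ?T \<cdot>\<^bsub>A\<^esub> (?C\<eta> \<cdot>\<^bsub>A\<^esub> inv_arrow A (\<Phi> Y))) \<cdot>\<^bsub>A\<^esub> \<delta> Y"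
    using S.F.A.comp_assoc[OF \<delta> C\<eta>\<Phi>' V.\<Omega>_hom[OF obj(3)]] S.F.A.comp_assoc[OF \<delta> \<Phi>' C\<eta>]
      inv_lift_comp_lift_compare[OF assms] by simp
  also have "\<dots> = \<phi> ?X (OMap V ?T) (lax_morphism A B F U \<phi> C V \<Phi> Y \<cdot>\<^bsub>B\<^esub> AMap F (\<delta> Y))"
    unfolding S.\<phi>_precomp[OF obj(4) \<delta> V.lax_morphism_hom[OF assms]] V.\<phi>_lax_morphism[OF assms] ..
  finally show ?thesis
    unfolding galois_def
    using S.\<psi>_\<phi>[OF obj(1,4) S.F.B.comp_hom[OF S.F.amap_hom[OF \<delta>] V.lax_morphism_hom[OF assms]]]
    by simp
qed

section \<open>Naturality of the Galois map\<close>

lemma nat_trans_galois_map: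
  "nat_trans (prod_cat (op_cat A) B) set_cat (hom_FS B F S) (hom_FS B F V)
     (galois_map A B F \<phi> S \<Omega> V \<Phi>)"
proof -
  \<comment> \<open>These two interpretations supply the functor part of \<open>nat_trans\<close>;
    only the typing and the naturality of the components remain.\<close>
  interpret FS: is_functor "prod_cat (op_cat A) B" set_cat "hom_FS B F S"
    by (rule is_functor_hom_FS[OF S.F.is_functor_axioms S.S.is_functor_axioms])
  interpret FV: is_functor "prod_cat (op_cat A) B" set_cat "hom_FS B F V"
    by (rule is_functor_hom_FS[OF S.F.is_functor_axioms V.S.is_functor_axioms])
  show ?thesis
  proof (unfold_locales, goal_cases)
    case (1 P)
    then obtain X Y where "P = (X, Y)" "X \<in> Obj A" "Y \<in> Obj B"
      by (auto simp: prod_cat_def op_cat_def)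
    then show ?case
      by (auto simp: Hom_set_cat OMap_hom_FS galois_map_eq galois_hom)
  next
    case (2 p P Q)
    obtain f g X Y X' Y' where eq: "p = (f, g)" "P = (X, Y)" "Q = (X', Y')"
      by (metis surj_pair)
    have f: "f \<in> Hom A X' X" and g: "g \<in> Hom B Y Y'"
      using 2 by (auto simp: eq Hom_prod_op)
    have obj: "X \<in> Obj A" "Y \<in> Obj B"
      using S.F.A.hom_obj[OF f] S.F.B.hom_obj[OF g] by auto
    have "AMap S g \<cdot>\<^bsub>B\<^esub> (h \<cdot>\<^bsub>B\<^esub> AMap F f) \<in> Hom B (OMap F X') (OMap S Y')"
      if "h \<in> Hom B (OMap F X) (OMap S Y)" for h
      using S.F.B.comp_hom[OF S.F.B.comp_hom[OF S.F.amap_hom[OF f] that] S.S.amap_hom[OF g]] .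
    then show ?case
      unfolding eq galois_map_eq
        AMap_hom_FS[OF S.F.is_functor_axioms S.S.is_functor_axioms f g]
        AMap_hom_FS[OF S.F.is_functor_axioms V.S.is_functor_axioms f g]
      by (auto simp: Comp_set_cat compose_def fun_eq_iff galois_hom[OF obj]
          galois_natural[OF f g])
  qed
qed

end

section \<open>The two Galois maps are mutually inverse\<close>

context two_lifts
begin

text \<open>The hypotheses are symmetric in the two lifts, so \<open>swap.galois\<close> is the
  Galois map in the opposite direction.\<close>

interpretation swap: two_lifts A B F U \<phi> C V \<Phi> S \<Omega> ..

text \<open>Between the two maps \<phi> and \<psi> cancel, leaving the two opposite comparisons,
  which compose to the identity in \<open>A\<close>.\<close>

lemma galois_inverse:
  assumes "X \<in> Obj A" "Y \<in> Obj B" "f \<in> Hom B (OMap F X) (OMap S Y)"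
  shows "swap.galois X Y (galois X Y f) = f"
  unfolding swap.galois_def \<phi>_galois[OF assms]
    lift_compare_inverse[OF assms(2) S.\<phi>_hom[OF assms(1) S.S.omap_obj[OF assms(2)] assms(3)]]
  by (rule S.\<psi>_\<phi>[OF assms(1) S.S.omap_obj[OF assms(2)] assms(3)])

end

context two_lifts
begin

text \<open>Interpreting afresh makes \<open>galois_inverse\<close> available for the exchanged pair
  too, which gives the other composite.\<close>

interpretation swap: two_lifts A B F U \<phi> C V \<Phi> S \<Omega> ..

lemma inverse_nat_trans_galois_map:
  "inverse_nat_trans (prod_cat (op_cat A) B) set_cat (hom_FS B F S) (hom_FS B F V)
     (galois_map A B F \<phi> S \<Omega> V \<Phi>) (galois_map A B F \<phi> V \<Phi> S \<Omega>)"
proof -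
  have "inverse_arrows set_cat (galois_map A B F \<phi> S \<Omega> V \<Phi> P) (galois_map A B F \<phi> V \<Phi> S \<Omega> P)"
    if "P \<in> Obj (prod_cat (op_cat A) B)" for P
  proof -
    obtain X Y where P: "P = (X, Y)"
      by (cases P)
    have obj: "X \<in> Obj A" "Y \<in> Obj B"
      using that by (auto simp: P prod_cat_def op_cat_def)
    have "galois_map A B F \<phi> S \<Omega> V \<Phi> P \<in>
        Hom set_cat (Hom B (OMap F X) (OMap S Y)) (Hom B (OMap F X) (OMap V Y))"
      by (auto simp: P galois_map_eq Hom_set_cat galois_hom[OF obj])
    moreover have "galois_map A B F \<phi> V \<Phi> S \<Omega> P \<in>
        Hom set_cat (Hom B (OMap F X) (OMap V Y)) (Hom B (OMap F X) (OMap S Y))"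
      by (auto simp: P swap.galois_map_eq Hom_set_cat swap.galois_hom[OF obj])
    \<comment> \<open>Arrows of \<open>set_cat\<close> are inverse when their functions are inverse
      on the hom-sets, and \<open>restrict_ext\<close> reduces this to the two versions of
      \<open>galois_inverse\<close>.\<close>
    ultimately show ?thesis
      by (auto simp: category.inverse_arrows_hom[OF category_set_cat] P galois_map_eq
          swap.galois_map_eq Comp_set_cat Ide_set_cat compose_def galois_hom[OF obj]
          swap.galois_hom[OF obj] galois_inverse[OF obj] swap.galois_inverse[OF obj]
          intro!: restrict_ext)
  qed
  then show ?thesis
    unfolding inverse_nat_trans_def
    using nat_trans_galois_map swap.nat_trans_galois_map by blast
qed

end

theorem proposition2p10:
  fixes A :: "('oa, 'ma) cat" and B :: "('ob, 'mb) cat"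
    and F :: "('oa, 'ma, 'ob, 'mb) ftr" and U :: "('ob, 'mb, 'oa, 'ma) ftr"
    and \<phi> :: "'oa \<Rightarrow> 'ob \<Rightarrow> 'mb \<Rightarrow> 'ma"
    and \<eta> :: "'oa \<Rightarrow> 'ma" and \<epsilon> :: "'ob \<Rightarrow> 'mb"
    and C :: "('oa, 'ma, 'oa, 'ma) ftr"
    and S V T :: "('ob, 'mb, 'ob, 'mb) ftr"
    and \<Omega> \<Phi> :: "'ob \<Rightarrow> 'ma"
    and \<Gamma>SV \<Gamma>VS :: "'oa \<times> 'ob \<Rightarrow> 'mb set_arr"
    and \<chi>S \<chi>V :: "'ob \<Rightarrow> 'mb"
  assumes adj: "adjunction A B F U \<phi>"
    and unit: "\<eta> = adj_unit B F \<phi>"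
    and counit: "\<epsilon> = adj_counit A B F U \<phi>"
    and endo: "is_functor A A C"
    and liftS: "is_lift A B U C S \<Omega>"
    and liftV: "is_lift A B U C V \<Phi>"
    and T_eq: "T = F \<odot> U"
    and \<Gamma>SV_eq: "\<Gamma>SV = galois_map A B F \<phi> S \<Omega> V \<Phi>"
    and \<Gamma>VS_eq: "\<Gamma>VS = galois_map A B F \<phi> V \<Phi> S \<Omega>"
    and \<chi>S_eq: "\<chi>S = lax_morphism A B F U \<phi> C S \<Omega>"
    and \<chi>V_eq: "\<chi>V = lax_morphism A B F U \<phi> C V \<Phi>"
  shows "inverse_nat_trans (prod_cat (op_cat A) B) set_cat (hom_FS B F S) (hom_FS B F V) \<Gamma>SV \<Gamma>VS
    \<and> (\<forall>X \<in> Obj A. \<forall>Y \<in> Obj B. \<forall>f \<in> Hom B (OMap F X) (OMap S Y).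
         set_map (\<Gamma>SV (X, Y)) f =
           \<epsilon> (OMap V Y) \<cdot>\<^bsub>B\<^esub> (AMap F (\<Phi> Y \<cdot>\<^bsub>A\<^esub> inv_arrow A (\<Omega> Y)) \<cdot>\<^bsub>B\<^esub>
             (AMap F (AMap U f) \<cdot>\<^bsub>B\<^esub> AMap F (\<eta> X))))
    \<and> (\<forall>Y \<in> Obj B.
         set_map (\<Gamma>SV (OMap U (OMap S Y), OMap T Y)) (\<chi>S Y) =
           \<chi>V Y \<cdot>\<^bsub>B\<^esub> AMap F (\<Phi> Y \<cdot>\<^bsub>A\<^esub> inv_arrow A (\<Omega> Y)))"
proof -
  interpret S: lift_through_adjunction A B F U \<phi> C S \<Omega>
    using adj endo liftS
    by (simp add: lift_through_adjunction_def lift_through_adjunction_axioms_def)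
  interpret V: lift_through_adjunction A B F U \<phi> C V \<Phi>
    using adj endo liftV
    by (simp add: lift_through_adjunction_def lift_through_adjunction_axioms_def)
  interpret two_lifts A B F U \<phi> C S \<Omega> V \<Phi> ..
  have "set_map (\<Gamma>SV (X, Y)) f = galois X Y f" if "f \<in> Hom B (OMap F X) (OMap S Y)" for X Y f
    using that by (simp add: \<Gamma>SV_eq galois_map_eq set_map_def)
  \<comment> \<open>This membership is needed because the Galois map is \<open>undefined\<close> off
    the hom-set; here its first argument is \<open>USY\<close> and its second is
    \<open>TY\<close>.\<close>
  moreover have "\<chi>S Y \<in> Hom B (OMap F (OMap U (OMap S Y))) (OMap S (OMap T Y))"
    if "Y \<in> Obj B" for Y
    using S.lax_morphism_hom[OF that] by (simp add: \<chi>S_eq T_eq comp_functor_def)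
  ultimately show ?thesis
    using inverse_nat_trans_galois_map galois_eq_composite galois_lax_morphism
    by (simp add: \<Gamma>SV_eq \<Gamma>VS_eq unit counit \<chi>S_eq \<chi>V_eq T_eq comp_functor_def lift_compare_eq)
qed

end
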